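(* Let $\mathbf{A}$ be a BL-algebra, $\mathbf{B}$ a BL-subalgebra of $\mathbf{A}$ and $c\in A$ such that $(B,c)$ is a $c$-relatively complete subalgebra. Define on $A$ the operations $\forall a:=\max\{b\in B: b\le c\to a\}$ and $\exists a:=\min\{b\in B: c\ast a\le b\}$. Then $\langle\mathbf{A},\forall,\exists\rangle$ is a c-EBL-algebra with focal element $c$, and $\forall A=\exists A=B$. Conversely, if $\langle\mathbf{A},\forall,\exists\rangle$ is a c-EBL-algebra with focal element $c$, then $(\forall A,c)$ is a $c$-relatively complete subalgebra of $\mathbf{A}$.
   Context: A BL-algebra is an algebra $\langle A,\wedge,\vee,\ast,\to,0,1\rangle$ such that $\langle A,\wedge,\vee,0,1\rangle$ is a bounded lattice (order $\le$), $\langle A,\ast,1\rangle$ is a commutative monoid, $a\ast b\le c$ iff $a\le b\to c$, and $a\wedge b=a\ast(a\to b)$ and $(a\to b)\vee(b\to a)=1$ hold; $c^2:=c\ast c$. An Epistemic BL-algebra (EBL-algebra) is a BL-algebra with unary operations $\forall,\exists$ satisfying, for all $a,b$: $\forall 1=1$; $\exists 0=0$; $\forall a\to\exists a=1$; $\forall(a\to\forall b)=\exists a\to\forall b$; $\forall(\forall a\to b)=\forall a\to\forall b$; $\exists a\to\forall\exists a=1$; $\forall(a\wedge b)=\forall a\wedge\forall b$; $\exists(a\vee b)=\exists a\vee\exists b$; $\exists(a\ast\exists b)=\exists a\ast\exists b$. If $\{a\in A:\forall a=1\}$ has a least element $c$, it is called the focal element, and the EBL-algebra is then called a c-EBL-algebra.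 For a BL-algebra $\mathbf{A}$, a subalgebra $\mathbf{B}$ and $c\in A$, the pair $(B,c)$ is a $c$-relatively complete subalgebra if (e1) for every $a\in A$ the set $\{b\in B: b\le c\to a\}$ has a greatest element and the set $\{b\in B: c\ast a\le b\}$ has a least element; and (e2) $\{a\in A: c^2\le a\}\cap B=\{1\}$. Here $\forall A=\{\forall a:a\in A\}$, $\exists A=\{\exists a: a\in A\}$. *)

theory Defs
  imports "HOL-Algebra.Group"
begin

text \<open>The monoid operation is \<open>\<otimes>\<close>; its unit \<open>\<one>\<close> is also the top of the lattice.\<close>

record 'a bl_struct = "'a monoid" +
  bl_meet :: "['a, 'a] \<Rightarrow> 'a" (infixl \<open>\<curlywedge>\<index>\<close> 70)
  bl_join :: "['a, 'a] \<Rightarrow> 'a" (infixl \<open>\<curlyvee>\<index>\<close> 65)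
  bl_imp :: "['a, 'a] \<Rightarrow> 'a" (infixr \<open>\<leadsto>\<index>\<close> 60)
  bl_zero :: 'a (\<open>\<zero>\<index>\<close>)

definition bl_order :: "('a, 'm) bl_struct_scheme \<Rightarrow> 'a gorder"
  where "bl_order L = \<lparr>carrier = carrier L, eq = (=), le = (\<lambda>x y. x \<curlywedge>\<^bsub>L\<^esub> y = x)\<rparr>"

abbreviation bl_le :: "('a, 'm) bl_struct_scheme \<Rightarrow> 'a \<Rightarrow> 'a \<Rightarrow> bool" (infixl \<open>\<preceq>\<index>\<close> 50)
  where "x \<preceq>\<^bsub>L\<^esub> y \<equiv> x \<sqsubseteq>\<^bsub>bl_order L\<^esub> y"

locale bl_algebra = comm_monoid L for L (structure) +
  assumes meet_closed: "\<lbrakk>a \<in> carrier L; b \<in> carrier L\<rbrakk> \<Longrightarrow> a \<curlywedge> b \<in> carrier L"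
    and join_closed: "\<lbrakk>a \<in> carrier L; b \<in> carrier L\<rbrakk> \<Longrightarrow> a \<curlyvee> b \<in> carrier L"
    and imp_closed: "\<lbrakk>a \<in> carrier L; b \<in> carrier L\<rbrakk> \<Longrightarrow> a \<leadsto> b \<in> carrier L"
    and zero_closed: "\<zero> \<in> carrier L"
    and meet_comm: "\<lbrakk>a \<in> carrier L; b \<in> carrier L\<rbrakk> \<Longrightarrow> a \<curlywedge> b = b \<curlywedge> a"
    and join_comm: "\<lbrakk>a \<in> carrier L; b \<in> carrier L\<rbrakk> \<Longrightarrow> a \<curlyvee> b = b \<curlyvee> a"
    and meet_assoc: "\<lbrakk>a \<in> carrier L; b \<in> carrier L; d \<in> carrier L\<rbrakk>
      \<Longrightarrow> (a \<curlywedge> b) \<curlywedge> d = a \<curlywedge> (b \<curlywedge> d)"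
    and join_assoc: "\<lbrakk>a \<in> carrier L; b \<in> carrier L; d \<in> carrier L\<rbrakk>
      \<Longrightarrow> (a \<curlyvee> b) \<curlyvee> d = a \<curlyvee> (b \<curlyvee> d)"
    and meet_absorb: "\<lbrakk>a \<in> carrier L; b \<in> carrier L\<rbrakk> \<Longrightarrow> a \<curlywedge> (a \<curlyvee> b) = a"
    and join_absorb: "\<lbrakk>a \<in> carrier L; b \<in> carrier L\<rbrakk> \<Longrightarrow> a \<curlyvee> (a \<curlywedge> b) = a"
    and zero_least: "a \<in> carrier L \<Longrightarrow> \<zero> \<preceq> a"
    and one_greatest: "a \<in> carrier L \<Longrightarrow> a \<preceq> \<one>"
    and residuation: "\<lbrakk>a \<in> carrier L; b \<in> carrier L; d \<in> carrier L\<rbrakk>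
      \<Longrightarrow> a \<otimes> b \<preceq> d \<longleftrightarrow> a \<preceq> b \<leadsto> d"
    and divisibility: "\<lbrakk>a \<in> carrier L; b \<in> carrier L\<rbrakk> \<Longrightarrow> a \<curlywedge> b = a \<otimes> (a \<leadsto> b)"
    and prelinearity: "\<lbrakk>a \<in> carrier L; b \<in> carrier L\<rbrakk> \<Longrightarrow> (a \<leadsto> b) \<curlyvee> (b \<leadsto> a) = \<one>"

locale bl_subalgebra =
  fixes B and L (structure)
  assumes subset: "B \<subseteq> carrier L"
    and zero_mem: "\<zero> \<in> B"
    and one_mem: "\<one> \<in> B"
    and meet_mem: "\<lbrakk>a \<in> B; b \<in> B\<rbrakk> \<Longrightarrow> a \<curlywedge> b \<in> B"
    and join_mem: "\<lbrakk>a \<in> B; b \<in> B\<rbrakk> \<Longrightarrow> a \<curlyvee> b \<in> B"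
    and mult_mem: "\<lbrakk>a \<in> B; b \<in> B\<rbrakk> \<Longrightarrow> a \<otimes> b \<in> B"
    and imp_mem: "\<lbrakk>a \<in> B; b \<in> B\<rbrakk> \<Longrightarrow> a \<leadsto> b \<in> B"

locale ebl_algebra = bl_algebra L for L (structure) +
  fixes fa ex :: "'a \<Rightarrow> 'a"
  assumes fa_closed: "a \<in> carrier L \<Longrightarrow> fa a \<in> carrier L"
    and ex_closed: "a \<in> carrier L \<Longrightarrow> ex a \<in> carrier L"
    and fa_one: "fa \<one> = \<one>"
    and ex_zero: "ex \<zero> = \<zero>"
    and fa_imp_ex: "a \<in> carrier L \<Longrightarrow> fa a \<leadsto> ex a = \<one>"
    and fa_imp_fa: "\<lbrakk>a \<in> carrier L; b \<in> carrier L\<rbrakk> \<Longrightarrow> fa (a \<leadsto> fa b) = ex a \<leadsto> fa b"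
    and fa_fa_imp: "\<lbrakk>a \<in> carrier L; b \<in> carrier L\<rbrakk> \<Longrightarrow> fa (fa a \<leadsto> b) = fa a \<leadsto> fa b"
    and ex_imp_fa_ex: "a \<in> carrier L \<Longrightarrow> ex a \<leadsto> fa (ex a) = \<one>"
    and fa_meet: "\<lbrakk>a \<in> carrier L; b \<in> carrier L\<rbrakk> \<Longrightarrow> fa (a \<curlywedge> b) = fa a \<curlywedge> fa b"
    and ex_join: "\<lbrakk>a \<in> carrier L; b \<in> carrier L\<rbrakk> \<Longrightarrow> ex (a \<curlyvee> b) = ex a \<curlyvee> ex b"
    and ex_mult_ex: "\<lbrakk>a \<in> carrier L; b \<in> carrier L\<rbrakk> \<Longrightarrow> ex (a \<otimes> ex b) = ex a \<otimes> ex b"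

definition focal_element :: "('a, 'm) bl_struct_scheme \<Rightarrow> ('a \<Rightarrow> 'a) \<Rightarrow> 'a \<Rightarrow> bool"
  where "focal_element L fa c \<longleftrightarrow> least (bl_order L) c {a \<in> carrier L. fa a = \<one>\<^bsub>L\<^esub>}"

locale c_ebl_algebra = ebl_algebra +
  assumes has_focal: "\<exists>c. focal_element L fa c"

locale c_relatively_complete = bl_subalgebra B L for B and L (structure) +
  fixes c
  assumes c_closed: "c \<in> carrier L"
    and e1_greatest: "a \<in> carrier L \<Longrightarrow> \<exists>m. greatest (bl_order L) m {b \<in> B. b \<preceq> c \<leadsto> a}"
    and e1_least: "a \<in> carrier L \<Longrightarrow> \<exists>m. least (bl_order L) m {b \<in> B. c \<otimes> a \<preceq> b}"
    and e2: "{a \<in> carrier L. c \<otimes> c \<preceq> a} \<inter> B = {\<one>}"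

definition rc_forall :: "('a, 'm) bl_struct_scheme \<Rightarrow> 'a set \<Rightarrow> 'a \<Rightarrow> 'a \<Rightarrow> 'a"
  where "rc_forall L B c a =
    (THE m. greatest (bl_order L) m {b \<in> B. b \<preceq>\<^bsub>L\<^esub> c \<leadsto>\<^bsub>L\<^esub> a})"

definition rc_exists :: "('a, 'm) bl_struct_scheme \<Rightarrow> 'a set \<Rightarrow> 'a \<Rightarrow> 'a \<Rightarrow> 'a"
  where "rc_exists L B c a =
    (THE m. least (bl_order L) m {b \<in> B. c \<otimes>\<^bsub>L\<^esub> a \<preceq>\<^bsub>L\<^esub> b})"

end

theory Submission
  imports Defs
begin

text \<open>
  On elements \<open>d\<close> of \<open>B\<close> the two operations are adjoints: \<open>d \<preceq> \<forall>a\<close> iff \<open>d \<otimes> c \<preceq> a\<close>, and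
  \<open>\<exists>a \<preceq> d\<close> iff \<open>c \<otimes> a \<preceq> d\<close>. Since both take values in \<open>B\<close>, every identity of an EBL-algebra
  follows by comparing the elements of \<open>B\<close> below (or above) its two sides; condition (e2) is
  needed only for \<open>\<forall>a \<preceq> \<exists>a\<close> and for \<open>\<forall>\<close>, \<open>\<exists>\<close> to fix \<open>B\<close> pointwise.
  Conversely, in an EBL-algebra the ranges of \<open>\<forall>\<close> and \<open>\<exists>\<close> coincide and consist of common fixed
  points, and \<open>\<forall>a = \<one>\<close> iff \<open>c \<preceq> a\<close>. Applying this equivalence to implications whose one side
  is such a fixed point turns the identities for \<open>\<forall>(a \<leadsto> \<forall>b)\<close> and \<open>\<forall>(\<forall>a \<leadsto> b)\<close> into the
  adjunctions.
\<close>

section \<open>Order and residuation in BL-algebras\<close>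

context bl_algebra
begin

lemma bl_le_iff: "x \<preceq> y \<longleftrightarrow> x \<curlywedge> y = x"
  by (simp add: bl_order_def)

lemma carrier_bl_order: "carrier (bl_order L) = carrier L"
  by (simp add: bl_order_def)

lemmas bl_closed = meet_closed join_closed imp_closed zero_closed m_closed one_closed

lemma bl_refl: "a \<in> carrier L \<Longrightarrow> a \<preceq> a"
  unfolding bl_le_iff by (metis join_absorb meet_absorb meet_closed)

lemma bl_antisym: "\<lbrakk>a \<preceq> b; b \<preceq> a; a \<in> carrier L; b \<in> carrier L\<rbrakk> \<Longrightarrow> a = b"
  unfolding bl_le_iff by (metis meet_comm)

lemma bl_trans:
  "\<lbrakk>a \<preceq> b; b \<preceq> d; a \<in> carrier L; b \<in> carrier L; d \<in> carrier L\<rbrakk> \<Longrightarrow> a \<preceq> d"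
  unfolding bl_le_iff by (metis meet_assoc)

lemma bl_le_meet_iff:
  assumes "a \<in> carrier L" "b \<in> carrier L" "d \<in> carrier L"
  shows "d \<preceq> a \<curlywedge> b \<longleftrightarrow> d \<preceq> a \<and> d \<preceq> b"
proof -
  have "a \<curlywedge> b \<preceq> a" "a \<curlywedge> b \<preceq> b"
    using assms bl_refl unfolding bl_le_iff by (metis meet_assoc meet_comm meet_closed)+
  then show ?thesis
    using assms bl_trans[of d "a \<curlywedge> b"] by (metis bl_le_iff meet_assoc meet_closed)
qed

lemma bl_le_iff_join: "\<lbrakk>a \<in> carrier L; b \<in> carrier L\<rbrakk> \<Longrightarrow> a \<preceq> b \<longleftrightarrow> a \<curlyvee> b = b"
  unfolding bl_le_iff by (metis join_absorb join_comm meet_absorb meet_comm)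

lemma bl_join_le_iff:
  assumes "a \<in> carrier L" "b \<in> carrier L" "d \<in> carrier L"
  shows "a \<curlyvee> b \<preceq> d \<longleftrightarrow> a \<preceq> d \<and> b \<preceq> d"
proof -
  have "a \<preceq> a \<curlyvee> b" "b \<preceq> a \<curlyvee> b"
    using assms meet_absorb unfolding bl_le_iff by (metis join_comm)+
  moreover have "a \<curlyvee> b \<preceq> d" if "a \<preceq> d" "b \<preceq> d"
    using that assms by (metis bl_le_iff_join join_assoc join_closed)
  ultimately show ?thesis
    using assms bl_trans[of _ "a \<curlyvee> b" d] join_closed by blast
qed

lemma imp_eq_one_iff:
  assumes "a \<in> carrier L" "b \<in> carrier L"
  shows "a \<leadsto> b = \<one> \<longleftrightarrow> a \<preceq> b"
  using assms residuation[of \<one> a b]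
  by (metis bl_antisym bl_refl imp_closed l_one one_closed one_greatest)

lemma residuation':
  assumes "a \<in> carrier L" "b \<in> carrier L" "d \<in> carrier L"
  shows "a \<otimes> b \<preceq> d \<longleftrightarrow> b \<preceq> a \<leadsto> d"
  using assms residuation[of b a d] by (simp add: m_comm)

lemma mult_le_right:
  assumes "a \<in> carrier L" "b \<in> carrier L"
  shows "a \<otimes> b \<preceq> b"
  using assms residuation[of a b b] by (simp add: imp_eq_one_iff[THEN iffD2] bl_refl one_greatest)

lemma mult_le_left: "\<lbrakk>a \<in> carrier L; b \<in> carrier L\<rbrakk> \<Longrightarrow> a \<otimes> b \<preceq> a"
  using mult_le_right[of b a] by (simp add: m_comm)

text \<open>Multiplication by \<open>c\<close> is a left adjoint, so it preserves joins; phrased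
  through upper bounds to fit \<open>ex_le_iff\<close>.\<close>

lemma mult_join_le_iff:
  assumes "a \<in> carrier L" "b \<in> carrier L" "c \<in> carrier L" "d \<in> carrier L"
  shows "c \<otimes> (a \<curlyvee> b) \<preceq> d \<longleftrightarrow> c \<otimes> a \<preceq> d \<and> c \<otimes> b \<preceq> d"
  using assms by (simp add: residuation' bl_join_le_iff bl_closed)

lemma one_le_iff: "a \<in> carrier L \<Longrightarrow> \<one> \<preceq> a \<longleftrightarrow> a = \<one>"
  using bl_antisym bl_refl one_greatest by blast

end

section \<open>From a relatively complete subalgebra to the quantifiers\<close>

locale bl_relatively_complete = bl_algebra L + c_relatively_complete B L c
  for L (structure) and B c
begin

abbreviation fa where "fa \<equiv> rc_forall L B c"
abbreviation ex where "ex \<equiv> rc_exists L B c"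

lemma in_carrier: "b \<in> B \<Longrightarrow> b \<in> carrier L"
  using subset by blast

text \<open>Existence is (e1) and uniqueness is antisymmetry, so the definite description denotes
  the maximum.\<close>

lemma fa_greatest:
  assumes "a \<in> carrier L"
  shows "greatest (bl_order L) (fa a) {b \<in> B. b \<preceq> c \<leadsto> a}"
  unfolding rc_forall_def
proof (rule theI')
  show "\<exists>!m. greatest (bl_order L) m {b \<in> B. b \<preceq> c \<leadsto> a}"
    using e1_greatest[OF assms] bl_antisym in_carrier unfolding greatest_def by blast
qed

lemma ex_least:
  assumes "a \<in> carrier L"
  shows "least (bl_order L) (ex a) {b \<in> B. c \<otimes> a \<preceq> b}"
  unfolding rc_exists_def
proof (rule theI')
  show "\<exists>!m. least (bl_order L) m {b \<in> B. c \<otimes> a \<preceq> b}"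
    using e1_least[OF assms] bl_antisym in_carrier unfolding least_def by blast
qed

lemma fa_mem: "a \<in> carrier L \<Longrightarrow> fa a \<in> B"
  and ex_mem: "a \<in> carrier L \<Longrightarrow> ex a \<in> B"
  using fa_greatest ex_least unfolding greatest_def least_def by blast+

lemma rc_fa_closed: "a \<in> carrier L \<Longrightarrow> fa a \<in> carrier L"
  and rc_ex_closed: "a \<in> carrier L \<Longrightarrow> ex a \<in> carrier L"
  by (simp_all add: fa_mem ex_mem in_carrier)

text \<open>The set whose maximum is \<open>fa a\<close> is downward closed in \<open>B\<close>, so
  it consists of exactly the elements of \<open>B\<close> below \<open>fa a\<close>. Residuation
  rewrites membership in it.\<close>

lemma le_fa_iff:
  assumes "a \<in> carrier L" "d \<in> B"
  shows "d \<preceq> fa a \<longleftrightarrow> d \<otimes> c \<preceq> a"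
proof -
  have "fa a \<preceq> c \<leadsto> a" "d \<preceq> c \<leadsto> a \<Longrightarrow> d \<preceq> fa a"
    using fa_greatest[OF assms(1)] assms(2) unfolding greatest_def by blast+
  then have "d \<preceq> fa a \<longleftrightarrow> d \<preceq> c \<leadsto> a"
    using bl_trans[of d "fa a" "c \<leadsto> a"] assms in_carrier rc_fa_closed imp_closed c_closed by blast
  then show ?thesis
    using assms by (simp add: residuation c_closed in_carrier)
qed

lemma ex_le_iff:
  assumes "a \<in> carrier L" "d \<in> B"
  shows "ex a \<preceq> d \<longleftrightarrow> c \<otimes> a \<preceq> d"
proof -
  have "c \<otimes> a \<preceq> ex a" "c \<otimes> a \<preceq> d \<Longrightarrow> ex a \<preceq> d"
    using ex_least[OF assms(1)] assms(2) unfolding least_def by blast+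
  then show ?thesis
    using bl_trans[of "c \<otimes> a" "ex a" d] assms in_carrier rc_ex_closed m_closed c_closed by blast
qed

text \<open>Test elements from \<open>B\<close> suffice because \<open>x\<close> and
  \<open>y\<close> are among them; the adjunctions speak only about such elements.\<close>

lemma eq_by_lower:
  assumes "x \<in> B" "y \<in> B" "\<And>d. d \<in> B \<Longrightarrow> d \<preceq> x \<longleftrightarrow> d \<preceq> y"
  shows "x = y"
  using assms by (metis bl_antisym bl_refl in_carrier)

lemma eq_by_upper:
  assumes "x \<in> B" "y \<in> B" "\<And>d. d \<in> B \<Longrightarrow> x \<preceq> d \<longleftrightarrow> y \<preceq> d"
  shows "x = y"
  using assms by (metis bl_antisym bl_refl in_carrier)

text \<open>The usable form of (e2): by residuation \<open>x \<leadsto> y\<close> is an element of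
  \<open>B\<close> above \<open>c \<otimes> c\<close>, hence it is \<open>\<one>\<close>.\<close>

lemma le_of_square_mult_le:
  assumes "x \<in> B" "y \<in> B" "(c \<otimes> c) \<otimes> x \<preceq> y"
  shows "x \<preceq> y"
proof -
  have "x \<leadsto> y \<in> {a \<in> carrier L. c \<otimes> c \<preceq> a} \<inter> B"
    using assms by (simp add: residuation[symmetric] imp_mem in_carrier c_closed imp_closed)
  then have "x \<leadsto> y = \<one>"
    using e2 by blast
  then show ?thesis
    using assms by (simp add: imp_eq_one_iff in_carrier)
qed

text \<open>A second factor \<open>c\<close> only lowers the left side, which reduces this to the
  square.\<close>

lemma le_of_mult_le:
  assumes "x \<in> B" "y \<in> B" "c \<otimes> x \<preceq> y"
  shows "x \<preceq> y"
proof (rule le_of_square_mult_le)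
  have cl: "c \<in> carrier L" "x \<in> carrier L" "y \<in> carrier L"
    using assms c_closed in_carrier by auto
  then have "c \<otimes> (c \<otimes> x) \<preceq> c \<otimes> x"
    by (simp add: mult_le_right)
  then show "(c \<otimes> c) \<otimes> x \<preceq> y"
    using cl assms(3) bl_trans[of "c \<otimes> (c \<otimes> x)" "c \<otimes> x" y] by (simp add: m_assoc)
qed (use assms in auto)

lemma mult_fa_le: "a \<in> carrier L \<Longrightarrow> c \<otimes> fa a \<preceq> a"
  using le_fa_iff[of a "fa a"] by (simp add: fa_mem rc_fa_closed bl_refl m_comm c_closed)

lemma mult_le_ex: "a \<in> carrier L \<Longrightarrow> c \<otimes> a \<preceq> ex a"
  using ex_le_iff[of a "ex a"] by (simp add: ex_mem rc_ex_closed bl_refl)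

lemma fa_fixed:
  assumes "b \<in> B"
  shows "fa b = b"
proof (rule bl_antisym)
  show "fa b \<preceq> b"
    using assms by (simp add: le_of_mult_le fa_mem mult_fa_le in_carrier)
  show "b \<preceq> fa b"
    using assms by (simp add: le_fa_iff mult_le_left in_carrier c_closed)
qed (use assms in \<open>simp_all add: in_carrier rc_fa_closed\<close>)

lemma ex_fixed:
  assumes "b \<in> B"
  shows "ex b = b"
proof (rule bl_antisym)
  show "ex b \<preceq> b"
    using assms by (simp add: ex_le_iff mult_le_right in_carrier c_closed)
  show "b \<preceq> ex b"
    using assms by (simp add: le_of_mult_le ex_mem mult_le_ex in_carrier)
qed (use assms in \<open>simp_all add: in_carrier rc_ex_closed\<close>)

text \<open>Here the square is essential: one factor \<open>c\<close> takes \<open>fa a\<close>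
  below \<open>a\<close>, and the other takes \<open>a\<close> below \<open>ex a\<close>.\<close>

lemma fa_le_ex:
  assumes "a \<in> carrier L"
  shows "fa a \<preceq> ex a"
proof (rule le_of_square_mult_le)
  have cl: "c \<in> carrier L" "fa a \<in> carrier L" "ex a \<in> carrier L"
    using assms c_closed rc_fa_closed rc_ex_closed by auto
  have "a \<preceq> c \<leadsto> ex a"
    using mult_le_ex[OF assms] cl assms by (simp add: residuation')
  then have "c \<otimes> fa a \<preceq> c \<leadsto> ex a"
    using mult_fa_le[OF assms] bl_trans[of "c \<otimes> fa a" a "c \<leadsto> ex a"] cl assms imp_closed by simp
  then show "(c \<otimes> c) \<otimes> fa a \<preceq> ex a"
    using cl by (simp add: residuation' m_assoc)
qed (use assms in \<open>simp_all add: fa_mem ex_mem\<close>)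

text \<open>The adjunction at \<open>d = \<one>\<close>; it makes \<open>c\<close> the least element
  that \<open>fa\<close> sends to \<open>\<one>\<close>.\<close>

lemma fa_eq_one_iff: "a \<in> carrier L \<Longrightarrow> fa a = \<one> \<longleftrightarrow> c \<preceq> a"
  using le_fa_iff[of a \<one>] by (simp add: one_mem c_closed one_le_iff rc_fa_closed)

sublocale ebl_algebra L fa ex
proof unfold_locales
  fix a assume a: "a \<in> carrier L"
  show "fa a \<in> carrier L" "ex a \<in> carrier L"
    by (simp_all add: a rc_fa_closed rc_ex_closed)
  show "fa a \<leadsto> ex a = \<one>"
    by (simp add: a imp_eq_one_iff rc_fa_closed rc_ex_closed fa_le_ex)
  show "ex a \<leadsto> fa (ex a) = \<one>"
    by (simp add: a fa_fixed ex_mem rc_ex_closed imp_eq_one_iff bl_refl)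
  fix b assume b: "b \<in> carrier L"
  note cl = a b c_closed rc_fa_closed rc_ex_closed fa_mem ex_mem in_carrier bl_closed
  show "fa (a \<leadsto> fa b) = ex a \<leadsto> fa b"
  proof (rule eq_by_lower)
    fix d assume d: "d \<in> B"
    have "d \<preceq> fa (a \<leadsto> fa b) \<longleftrightarrow> d \<otimes> (c \<otimes> a) \<preceq> fa b"
      using d by (simp add: le_fa_iff cl residuation[symmetric] m_assoc)
    \<comment> \<open>Moving \<open>d\<close> to the right leaves \<open>c \<otimes> a\<close> below
      \<open>d \<leadsto> fa b\<close>, a bound in \<open>B\<close>, so the adjunction for
      \<open>ex\<close> applies.\<close>
    also have "\<dots> \<longleftrightarrow> ex a \<preceq> d \<leadsto> fa b"
      using d by (simp add: ex_le_iff cl residuation' imp_mem)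
    also have "\<dots> \<longleftrightarrow> d \<preceq> ex a \<leadsto> fa b"
      using d by (simp add: cl residuation[symmetric] m_comm)
    finally show "d \<preceq> fa (a \<leadsto> fa b) \<longleftrightarrow> d \<preceq> ex a \<leadsto> fa b" .
  qed (simp_all add: cl imp_mem)
  show "fa (fa a \<leadsto> b) = fa a \<leadsto> fa b"
  proof (rule eq_by_lower)
    fix d assume d: "d \<in> B"
    have "d \<preceq> fa (fa a \<leadsto> b) \<longleftrightarrow> (d \<otimes> fa a) \<otimes> c \<preceq> b"
      using d by (simp add: le_fa_iff cl residuation[symmetric] m_ac)
    \<comment> \<open>The test element is now \<open>d \<otimes> fa a\<close>, which is in
      \<open>B\<close> because \<open>B\<close> is closed under products.\<close>
    also have "\<dots> \<longleftrightarrow> d \<otimes> fa a \<preceq> fa b"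
      using d by (simp add: le_fa_iff cl mult_mem)
    also have "\<dots> \<longleftrightarrow> d \<preceq> fa a \<leadsto> fa b"
      using d by (simp add: cl residuation)
    finally show "d \<preceq> fa (fa a \<leadsto> b) \<longleftrightarrow> d \<preceq> fa a \<leadsto> fa b" .
  qed (simp_all add: cl imp_mem)
  show "fa (a \<curlywedge> b) = fa a \<curlywedge> fa b"
    by (rule eq_by_lower) (simp_all add: cl meet_mem bl_le_meet_iff le_fa_iff)
  show "ex (a \<curlyvee> b) = ex a \<curlyvee> ex b"
    by (rule eq_by_upper) (simp_all add: cl join_mem bl_join_le_iff ex_le_iff mult_join_le_iff)
  show "ex (a \<otimes> ex b) = ex a \<otimes> ex b"
  proof (rule eq_by_upper)
    fix d assume d: "d \<in> B"
    have "ex (a \<otimes> ex b) \<preceq> d \<longleftrightarrow> (c \<otimes> a) \<otimes> ex b \<preceq> d"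
      using d by (simp add: ex_le_iff cl m_assoc)
    \<comment> \<open>The factor \<open>ex b\<close> moves into the bound, which stays in
      \<open>B\<close>.\<close>
    also have "\<dots> \<longleftrightarrow> ex a \<preceq> ex b \<leadsto> d"
      using d by (simp add: ex_le_iff cl imp_mem residuation)
    also have "\<dots> \<longleftrightarrow> ex a \<otimes> ex b \<preceq> d"
      using d by (simp add: cl residuation)
    finally show "ex (a \<otimes> ex b) \<preceq> d \<longleftrightarrow> ex a \<otimes> ex b \<preceq> d" .
  qed (simp_all add: cl mult_mem)
qed (simp_all add: fa_fixed ex_fixed one_mem zero_mem)

lemma focal: "focal_element L fa c"
  unfolding focal_element_def least_def
  by (auto simp: carrier_bl_order fa_eq_one_iff c_closed bl_refl)

lemma c_ebl: "c_ebl_algebra L fa ex"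
  by unfold_locales (use focal in blast)

lemma fa_image: "fa ` carrier L = B"
proof
  show "fa ` carrier L \<subseteq> B"
    using fa_mem by blast
  show "B \<subseteq> fa ` carrier L"
    by (metis fa_fixed image_eqI in_carrier subsetI)
qed

lemma ex_image: "ex ` carrier L = B"
proof
  show "ex ` carrier L \<subseteq> B"
    using ex_mem by blast
  show "B \<subseteq> ex ` carrier L"
    by (metis ex_fixed image_eqI in_carrier subsetI)
qed

end

section \<open>From a c-EBL-algebra to a relatively complete subalgebra\<close>

context ebl_algebra
begin

lemmas ebl_closed = fa_closed ex_closed bl_closed

lemma ex_eq_one_of_fa_eq_one:
  assumes "a \<in> carrier L" "fa a = \<one>"
  shows "ex a = \<one>"
  using fa_imp_ex[OF assms(1)] assms by (simp add: imp_eq_one_iff ebl_closed one_le_iff)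

lemma ex_one: "ex \<one> = \<one>"
  by (simp add: ex_eq_one_of_fa_eq_one fa_one)

lemma one_imp: "a \<in> carrier L \<Longrightarrow> \<one> \<leadsto> a = a"
  using divisibility[of \<one> a] one_greatest[of a] by (simp add: bl_le_iff meet_comm ebl_closed)

text \<open>The identity for \<open>fa (a \<leadsto> fa b)\<close> with \<open>\<one>\<close> as the
  antecedent, since \<open>ex \<one> = \<one>\<close>.\<close>

lemma fa_fa: "a \<in> carrier L \<Longrightarrow> fa (fa a) = fa a"
  using fa_imp_fa[of \<one> a] by (simp add: ex_one one_imp ebl_closed)

lemma ex_ex: "a \<in> carrier L \<Longrightarrow> ex (ex a) = ex a"
  using ex_mult_ex[of \<one> a] by (simp add: ex_one ebl_closed)

lemma fa_ex:
  assumes "a \<in> carrier L"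
  shows "fa (ex a) = ex a"
  using assms fa_imp_ex[of "ex a"] ex_imp_fa_ex[of a]
  by (simp add: ex_ex imp_eq_one_iff ebl_closed bl_antisym)

lemma ex_fa:
  assumes "a \<in> carrier L"
  shows "ex (fa a) = fa a"
proof (rule bl_antisym)
  \<comment> \<open>By \<open>fa_imp_fa\<close> the same term equals
    \<open>ex (fa a) \<leadsto> fa a\<close>.\<close>
  have "fa (fa a \<leadsto> fa a) = \<one>"
    using assms by (simp add: imp_eq_one_iff[THEN iffD2] bl_refl fa_one ebl_closed)
  then have "ex (fa a) \<leadsto> fa a = \<one>"
    using assms fa_imp_fa[of "fa a" a] by (simp add: ebl_closed)
  then show "ex (fa a) \<preceq> fa a"
    using assms by (simp add: imp_eq_one_iff ebl_closed)
  show "fa a \<preceq> ex (fa a)"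
    using assms fa_imp_ex[of "fa a"] by (simp add: fa_fa imp_eq_one_iff ebl_closed)
qed (use assms in \<open>simp_all add: ebl_closed\<close>)

lemma fa_image_of_fa_fixed: "\<lbrakk>b \<in> carrier L; fa b = b\<rbrakk> \<Longrightarrow> b \<in> fa ` carrier L"
  by (rule image_eqI[OF sym])

lemma fa_image_of_ex_fixed: "\<lbrakk>b \<in> carrier L; ex b = b\<rbrakk> \<Longrightarrow> b \<in> fa ` carrier L"
  using fa_ex[of b] by (simp add: fa_image_of_fa_fixed)

lemma fa_image_iff: "b \<in> fa ` carrier L \<longleftrightarrow> b \<in> carrier L \<and> fa b = b \<and> ex b = b"
  using fa_image_of_fa_fixed fa_fa ex_fa fa_closed by blast

text \<open>Each operation is handled by a quantifier that respects it on fixed points: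
  \<open>fa\<close> for \<open>\<one>\<close>, meet and implication, \<open>ex\<close> for
  \<open>\<zero>\<close>, join and product.\<close>

lemma fa_image_subalgebra: "bl_subalgebra (fa ` carrier L) L"
proof
  show "fa ` carrier L \<subseteq> carrier L"
    using fa_closed by blast
  show "\<zero> \<in> fa ` carrier L"
    by (simp add: fa_image_of_ex_fixed ex_zero zero_closed)
  show "\<one> \<in> fa ` carrier L"
    by (simp add: fa_image_of_fa_fixed fa_one)
  fix a b assume "a \<in> fa ` carrier L" "b \<in> fa ` carrier L"
  then have ab: "a \<in> carrier L" "fa a = a" "ex a = a" "b \<in> carrier L" "fa b = b" "ex b = b"
    unfolding fa_image_iff by auto
  show "a \<curlywedge> b \<in> fa ` carrier L"
    using ab by (simp add: fa_image_of_fa_fixed fa_meet meet_closed)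
  show "a \<curlyvee> b \<in> fa ` carrier L"
    using ab by (simp add: fa_image_of_ex_fixed ex_join join_closed)
  show "a \<otimes> b \<in> fa ` carrier L"
    using ab ex_mult_ex[of a b] by (simp add: fa_image_of_ex_fixed)
  show "a \<leadsto> b \<in> fa ` carrier L"
    using ab fa_fa_imp[of a b] by (simp add: fa_image_of_fa_fixed imp_closed)
qed

text \<open>Since \<open>fa\<close> preserves meets, the elements it sends to \<open>\<one>\<close>
  form an upward closed set, and \<open>c\<close> is its least element.\<close>

lemma focal_le_iff:
  assumes "focal_element L fa c" "a \<in> carrier L"
  shows "c \<preceq> a \<longleftrightarrow> fa a = \<one>"
proof
  have c: "c \<in> carrier L" "fa c = \<one>"
    using assms(1) unfolding focal_element_def least_def by auto
  show "fa a = \<one> \<Longrightarrow> c \<preceq> a"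
    using assms unfolding focal_element_def least_def by auto
  assume "c \<preceq> a"
  then have "\<one> = fa c \<curlywedge> fa a"
    using c assms(2) fa_meet[of c a] by (simp add: bl_le_iff)
  then have "\<one> \<preceq> fa a"
    using c by (simp add: bl_le_iff)
  then show "fa a = \<one>"
    using assms(2) by (simp add: one_le_iff fa_closed)
qed

lemma focal_relatively_complete:
  assumes focal: "focal_element L fa c"
  shows "c_relatively_complete (fa ` carrier L) L c"
proof -
  interpret bl_subalgebra "fa ` carrier L" L
    by (rule fa_image_subalgebra)
  note c_le_iff = focal_le_iff[OF focal]
  have c: "c \<in> carrier L" "fa c = \<one>"
    using focal unfolding focal_element_def least_def by auto
  have below: "b \<preceq> c \<leadsto> a \<longleftrightarrow> b \<preceq> fa a" if "a \<in> carrier L" "b \<in> fa ` carrier L" for a b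
  proof -
    have b: "b \<in> carrier L" "fa b = b"
      using that fa_image_iff by auto
    \<comment> \<open>Exchanging \<open>b\<close> and \<open>c\<close> isolates \<open>c\<close> on
      the left, where \<open>c_le_iff\<close> turns the inequality into
      \<open>fa (b \<leadsto> a) = \<one>\<close>.\<close>
    have "b \<preceq> c \<leadsto> a \<longleftrightarrow> c \<preceq> b \<leadsto> a"
      using that b c by (simp add: residuation[symmetric] m_comm)
    also have "\<dots> \<longleftrightarrow> b \<preceq> fa a"
      using that b fa_fa_imp[of b a] by (simp add: c_le_iff ebl_closed imp_eq_one_iff)
    finally show ?thesis .
  qed
  have above: "c \<otimes> a \<preceq> b \<longleftrightarrow> ex a \<preceq> b" if "a \<in> carrier L" "b \<in> fa ` carrier L" for a b
  proof -
    have b: "b \<in> carrier L" "fa b = b"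
      using that fa_image_iff by auto
    then show ?thesis
      using that c fa_imp_fa[of a b] by (simp add: residuation c_le_iff ebl_closed imp_eq_one_iff)
  qed
  show ?thesis
  proof
    show "c \<in> carrier L"
      by (rule c)
    fix a assume a: "a \<in> carrier L"
    have "greatest (bl_order L) (fa a) {b \<in> fa ` carrier L. b \<preceq> c \<leadsto> a}"
      using a subset unfolding greatest_def
      by (auto simp: carrier_bl_order below bl_refl fa_closed)
    then show "\<exists>m. greatest (bl_order L) m {b \<in> fa ` carrier L. b \<preceq> c \<leadsto> a}" ..
    have "ex a \<in> fa ` carrier L"
      using a by (simp add: fa_image_of_ex_fixed ex_ex ex_closed)
    then have "least (bl_order L) (ex a) {b \<in> fa ` carrier L. c \<otimes> a \<preceq> b}"
      using a subset unfolding least_def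
      by (auto simp: carrier_bl_order above bl_refl ex_closed)
    then show "\<exists>m. least (bl_order L) m {b \<in> fa ` carrier L. c \<otimes> a \<preceq> b}" ..
  next
    \<comment> \<open>By \<open>above\<close> at \<open>c\<close> itself,
      \<open>c \<otimes> c \<preceq> a\<close> means \<open>ex c \<preceq> a\<close>, and
      \<open>ex c = \<one>\<close> because \<open>fa c = \<one>\<close>.\<close>
    have "a = \<one>" if "a \<in> fa ` carrier L" "c \<otimes> c \<preceq> a" for a
      using that above[of c a] c ex_eq_one_of_fa_eq_one[of c] subset by (auto simp: one_le_iff)
    moreover have "c \<otimes> c \<preceq> \<one>"
      using c by (simp add: one_greatest)
    ultimately show "{a \<in> carrier L. c \<otimes> c \<preceq> a} \<inter> fa ` carrier L = {\<one>}"
      using one_mem one_closed by blast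
  qed
qed

end

theorem theorem8:
  fixes L :: "('a, 'm) bl_struct_scheme"
  assumes "bl_algebra L"
  shows "(\<forall>B c. c_relatively_complete B L c \<longrightarrow>
            c_ebl_algebra L (rc_forall L B c) (rc_exists L B c) \<and>
            focal_element L (rc_forall L B c) c \<and>
            rc_forall L B c ` carrier L = B \<and>
            rc_exists L B c ` carrier L = B) \<and>
         (\<forall>fa ex c. c_ebl_algebra L fa ex \<and> focal_element L fa c \<longrightarrow>
            c_relatively_complete (fa ` carrier L) L c)"
proof (intro conjI allI impI)
  fix B c assume "c_relatively_complete B L c"
  then interpret bl_relatively_complete L B c
    using assms by (simp add: bl_relatively_complete_def)
  show "c_ebl_algebra L (rc_forall L B c) (rc_exists L B c)"
    by (rule c_ebl)
  show "focal_element L (rc_forall L B c) c"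
    by (rule focal)
  show "rc_forall L B c ` carrier L = B"
    by (rule fa_image)
  show "rc_exists L B c ` carrier L = B"
    by (rule ex_image)
next
  fix fa ex c assume *: "c_ebl_algebra L fa ex \<and> focal_element L fa c"
  then interpret c_ebl_algebra L fa ex
    by blast
  show "c_relatively_complete (fa ` carrier L) L c"
    using * focal_relatively_complete by blast
qed

end
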